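(* Let $K$ be a compact space. The following conditions are equivalent: (a) $K$ is scattered; (b) $C_p(K)$ is Fréchet-Urysohn; (c) $C_p(K)$ does not have the property (B).
   Context: All topological spaces are assumed to be Tychonoff, so compact spaces are compact Hausdorff. $C_p(K)$ denotes the set of all real-valued continuous functions on $K$ equipped with the pointwise topology, i.e. the topology inherited from the product space $\mathbb{R}^K$. A space $X$ is scattered if no nonempty subset $A\subseteq X$ is dense-in-itself (i.e. every nonempty subspace has an isolated point). A space $X$ is Fréchet-Urysohn if for any $A\subseteq X$ and $x\in\overline{A}$ there is a sequence of points of $A$ converging to $x$. A space $X$ has the property (B) if $X$ can be covered by countably many closed nowhere-dense sets $\{A_n:n\in\omega\}$ such that for any compact set $C\subseteq X$ there exists $n\in\omega$ with $C\subseteq A_n$. *)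

theory Defs
  imports "HOL-Analysis.Analysis"
begin

text \<open>Elements of \<open>Cp K\<close> are extensional functions on \<^term>\<open>topspace K\<close>
  (equal to \<^const>\<open>undefined\<close> outside), because the carrier of
  \<^const>\<open>product_topology\<close> is an extensional function space. Thus each continuous
  function on \<open>K\<close> is represented exactly once.\<close>

definition Cp :: "'a topology \<Rightarrow> ('a \<Rightarrow> real) topology" where
  "Cp K = subtopology (product_topology (\<lambda>_. euclideanreal) (topspace K))
            {f. continuous_map K euclideanreal f}"

definition dense_in_itself :: "'a topology \<Rightarrow> 'a set \<Rightarrow> bool" where
  "dense_in_itself X A \<longleftrightarrow> A \<subseteq> topspace X \<and> A \<subseteq> X derived_set_of A"

definition scattered_space :: "'a topology \<Rightarrow> bool" where
  "scattered_space X \<longleftrightarrow>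
     \<not> (\<exists>A. A \<subseteq> topspace X \<and> A \<noteq> {} \<and> dense_in_itself X A)"

definition frechet_urysohn_space :: "'a topology \<Rightarrow> bool" where
  "frechet_urysohn_space X \<longleftrightarrow>
     (\<forall>A x. A \<subseteq> topspace X \<and> x \<in> X closure_of A \<longrightarrow>
        (\<exists>s :: nat \<Rightarrow> 'a. range s \<subseteq> A \<and> limitin X s x sequentially))"

definition nowhere_dense_in :: "'a topology \<Rightarrow> 'a set \<Rightarrow> bool" where
  "nowhere_dense_in X A \<longleftrightarrow>
     A \<subseteq> topspace X \<and> X interior_of (X closure_of A) = {}"

definition property_B :: "'a topology \<Rightarrow> bool" where
  "property_B X \<longleftrightarrow>
     (\<exists>A :: nat \<Rightarrow> 'a set.
        (\<forall>n. closedin X (A n) \<and> nowhere_dense_in X (A n)) \<and>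
        topspace X = (\<Union>n. A n) \<and>
        (\<forall>C. compactin X C \<longrightarrow> (\<exists>n. C \<subseteq> A n)))"

end

theory Submission
  imports Defs
begin

text \<open>
  Suppose \<open>K\<close> is scattered. A point in the closure of \<open>A\<close> is in the closure of a countable
  \<open>B \<subseteq> A\<close>, because every power \<open>K\<^sup>n\<close> is compact. Countably many continuous functions
  identify the points of \<open>K\<close> up to countably many classes, so pointwise convergence on \<open>K\<close> of
  a sequence from \<open>B\<close> has to be arranged at countably many points only.

  In a nonempty Hausdorff Frechet-Urysohn space with a cover witnessing (B), a diagonal
  argument gives a convergent sequence that is contained in no member of the cover.

  Suppose \<open>K\<close> is not scattered. A Cantor scheme in \<open>K\<close> is a countable family of nonempty
  closed sets, each containing two disjoint members. Let \<open>L\<close> be minimal among the closed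
  sets that meet all members. By minimality every nonempty relatively open subset of \<open>L\<close>
  contains a trace \<open>P \<inter> L\<close>, and all traces are infinite. A compact \<open>C \<subseteq> C\<^sub>p(K)\<close> is
  pointwise bounded, so by the Baire theorem in \<open>L\<close> it is uniformly bounded on a trace. Hence
  the sets \<open>{f. \<bar>f\<bar> \<le> m on P \<inter> L}\<close> witness (B).
\<close>

section \<open>The space of continuous functions\<close>

lemma topspace_Cp:
  "topspace (Cp K) = {f. continuous_map K euclideanreal f} \<inter> extensional (topspace K)"
  by (auto simp: Cp_def PiE_def)

lemma restrict_in_Cp:
  assumes "continuous_map K euclideanreal f"
  shows "restrict f (topspace K) \<in> topspace (Cp K)"
  using assms by (auto simp: topspace_Cp intro: continuous_map_eq)

lemma Hausdorff_space_Cp: "Hausdorff_space (Cp K)"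
  unfolding Cp_def
  by (intro Hausdorff_space_subtopology) (simp add: Hausdorff_space_product_topology)

lemma continuous_map_Cp_eval:
  assumes "x \<in> topspace K"
  shows "continuous_map (Cp K) euclideanreal (\<lambda>f. f x)"
  unfolding Cp_def
  using assms by (intro continuous_map_from_subtopology continuous_map_product_projection) auto

lemma limitin_Cp_iff:
  assumes "f \<in> topspace (Cp K)" "\<And>n. s n \<in> topspace (Cp K)"
  shows "limitin (Cp K) s f F \<longleftrightarrow> (\<forall>x\<in>topspace K. ((\<lambda>n. s n x) \<longlongrightarrow> f x) F)"
  using assms
  by (auto simp: Cp_def limitin_subtopology limitin_componentwise PiE_def)

text \<open>A basic open set of the product restricts only finitely many coordinates, so one radius
  \<open>e\<close> serves for all of them.\<close>

lemma openin_Cp_basic: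
  assumes W: "openin (Cp K) W" "f \<in> W"
  obtains S e where "finite S" "S \<subseteq> topspace K" "e > 0"
    "\<forall>g\<in>topspace (Cp K). (\<forall>x\<in>S. \<bar>g x - f x\<bar> < e) \<longrightarrow> g \<in> W"
proof -
  obtain T where T: "openin (product_topology (\<lambda>_. euclideanreal) (topspace K)) T"
    and WT: "W = T \<inter> {f. continuous_map K euclideanreal f}"
    using W by (auto simp: Cp_def openin_subtopology)
  obtain U where fin: "finite {x \<in> topspace K. U x \<noteq> UNIV}"
    and op: "\<And>x. x \<in> topspace K \<Longrightarrow> open (U x)"
    and fU: "f \<in> Pi\<^sub>E (topspace K) U" and UT: "Pi\<^sub>E (topspace K) U \<subseteq> T"
    using T W(2) WT unfolding openin_product_topology_alt by fastforce
  define S where "S = {x \<in> topspace K. U x \<noteq> UNIV}"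
  have "\<forall>x\<in>S. \<exists>e>0. \<forall>y. dist y (f x) < e \<longrightarrow> y \<in> U x"
    using op fU unfolding S_def open_dist by (auto simp: PiE_def Pi_def)
  then obtain d where d: "\<And>x. x \<in> S \<Longrightarrow> d x > 0 \<and> (\<forall>y. dist y (f x) < d x \<longrightarrow> y \<in> U x)"
    by metis
  \<comment> \<open>The inserted 1 keeps the minimum defined when \<open>S\<close> is empty.\<close>
  define e where "e = Min (insert 1 (d ` S))"
  have "finite S" using fin by (simp add: S_def)
  have "e > 0" and ed: "\<And>x. x \<in> S \<Longrightarrow> e \<le> d x"
    using \<open>finite S\<close> d by (auto simp: e_def)
  show thesis
  proof
    show "finite S" "S \<subseteq> topspace K" "e > 0"
      using \<open>finite S\<close> \<open>e > 0\<close> by (auto simp: S_def)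
    show "\<forall>g\<in>topspace (Cp K). (\<forall>x\<in>S. \<bar>g x - f x\<bar> < e) \<longrightarrow> g \<in> W"
    proof clarify
      fix g assume g: "g \<in> topspace (Cp K)" "\<forall>x\<in>S. \<bar>g x - f x\<bar> < e"
      have "g x \<in> U x" if "x \<in> topspace K" for x
      proof (cases "x \<in> S")
        case True
        then show ?thesis using g(2) d ed by (fastforce simp: dist_real_def)
      next
        case False
        then show ?thesis using that by (auto simp: S_def)
      qed
      then have "g \<in> Pi\<^sub>E (topspace K) U"
        using g(1) by (auto simp: topspace_Cp PiE_def)
      then show "g \<in> W" using UT WT g(1) by (auto simp: topspace_Cp)
    qed
  qed
qed

text \<open>Turns closure into approximation at finitely many points, the form in which countable
  subsets and sequences are selected later.\<close>

lemma in_closure_of_Cp_iff: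
  assumes "f \<in> topspace (Cp K)" "A \<subseteq> topspace (Cp K)"
  shows "f \<in> Cp K closure_of A \<longleftrightarrow>
    (\<forall>S e. finite S \<and> S \<subseteq> topspace K \<and> e > 0 \<longrightarrow> (\<exists>g\<in>A. \<forall>x\<in>S. \<bar>g x - f x\<bar> < e))"
    (is "?L \<longleftrightarrow> ?R")
proof
  assume ?L
  show ?R
  proof clarify
    fix S and e :: real assume S: "finite S" "S \<subseteq> topspace K" "e > 0"
    have op: "openin (Cp K) {g \<in> topspace (Cp K). g x \<in> ball (f x) e}" if "x \<in> S" for x
      using openin_continuous_map_preimage[OF continuous_map_Cp_eval, of x K "ball (f x) e"] that S
      by auto
    have "openin (Cp K) (topspace (Cp K) \<inter> (\<Inter>x\<in>S. {g \<in> topspace (Cp K). g x \<in> ball (f x) e}))"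
      using S op by (intro openin_Int_Inter) auto
    moreover have "f \<in> topspace (Cp K) \<inter> (\<Inter>x\<in>S. {g \<in> topspace (Cp K). g x \<in> ball (f x) e})"
      using assms S by auto
    ultimately obtain g where "g \<in> A" "g \<in> (\<Inter>x\<in>S. {g \<in> topspace (Cp K). g x \<in> ball (f x) e})"
      using \<open>?L\<close> unfolding in_closure_of by blast
    then have "\<forall>x\<in>S. \<bar>g x - f x\<bar> < e"
      by (auto simp: dist_real_def abs_minus_commute)
    then show "\<exists>g\<in>A. \<forall>x\<in>S. \<bar>g x - f x\<bar> < e"
      using \<open>g \<in> A\<close> by blast
  qed
next
  assume R: ?R
  show ?L
    unfolding in_closure_of
  proof (intro conjI allI impI)
    fix T assume "f \<in> T \<and> openin (Cp K) T"
    then obtain S e where "finite S" "S \<subseteq> topspace K" "e > 0"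
      and T: "\<forall>g\<in>topspace (Cp K). (\<forall>x\<in>S. \<bar>g x - f x\<bar> < e) \<longrightarrow> g \<in> T"
      using openin_Cp_basic[of K T f] by metis
    with R obtain g where "g \<in> A" "\<forall>x\<in>S. \<bar>g x - f x\<bar> < e" by meson
    then show "\<exists>y. y \<in> A \<and> y \<in> T" using T assms by blast
  qed (use assms in auto)
qed

section \<open>Scattered compact spaces\<close>

text \<open>For each \<open>n\<close>, the open sets \<open>U g\<close> of \<open>n\<close>-tuples
  on which \<open>g\<close> approximates \<open>f\<close> cover the compact power. A finite subcover
  gives a finite \<open>B n\<close>, and the union of all \<open>B n\<close> suffices.\<close>

lemma countable_tightness_Cp:
  assumes K: "compact_space K" and A: "A \<subseteq> topspace (Cp K)" and f: "f \<in> Cp K closure_of A"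
  obtains B where "countable B" "B \<subseteq> A" "f \<in> Cp K closure_of B"
proof -
  have fC: "f \<in> topspace (Cp K)" using f by (meson closure_of_subset_topspace subsetD)
  have "\<exists>B. finite B \<and> B \<subseteq> A \<and> (\<forall>t\<in>{..<n} \<rightarrow>\<^sub>E topspace K. \<exists>g\<in>B. \<forall>i<n. \<bar>g (t i) - f (t i)\<bar> < 1 / real (Suc n))" for n
  proof -
    define X where "X = product_topology (\<lambda>_. K) {..<n}"
    have cX: "compact_space X" using K by (simp add: X_def compact_space_product_topology)
    define U where "U g = {t \<in> topspace X. \<forall>i\<in>{..<n}. g (t i) - f (t i) \<in> ball 0 (1 / real (Suc n))}" for g
    have "openin X (U g)" if "g \<in> A" for g
    proof -
      have "continuous_map K euclideanreal (\<lambda>x. g x - f x)"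
        using that A fC by (intro continuous_intros) (auto simp: topspace_Cp)
      then have "continuous_map X euclideanreal (\<lambda>t. g (t i) - f (t i))" if "i < n" for i
        using continuous_map_compose[OF continuous_map_product_projection, of i "{..<n}" "\<lambda>_. K" euclideanreal "\<lambda>x. g x - f x"] that
        by (simp add: o_def X_def)
      then have op: "openin X {t \<in> topspace X. g (t i) - f (t i) \<in> ball 0 (1 / real (Suc n))}" if "i < n" for i
        using that by (intro openin_continuous_map_preimage) auto
      have "U g = topspace X \<inter> (\<Inter>i\<in>{..<n}. {t \<in> topspace X. g (t i) - f (t i) \<in> ball 0 (1 / real (Suc n))})"
        by (auto simp: U_def)
      also have "openin X \<dots>"
        using op by (intro openin_Int_Inter) auto
      finally show ?thesis .
    qed
    moreover have "topspace X \<subseteq> \<Union>(U ` A)"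
    proof
      fix t assume t: "t \<in> topspace X"
      then have "t ` {..<n} \<subseteq> topspace K" by (auto simp: X_def PiE_def Pi_def)
      then obtain g where "g \<in> A" "\<forall>x\<in>t ` {..<n}. \<bar>g x - f x\<bar> < 1 / real (Suc n)"
        using f unfolding in_closure_of_Cp_iff[OF fC A] by (metis finite_imageI finite_lessThan of_nat_0_less_iff zero_less_Suc zero_less_divide_1_iff)
      then have "t \<in> U g" using t by (auto simp: U_def)
      then show "t \<in> \<Union>(U ` A)" using \<open>g \<in> A\<close> by blast
    qed
    ultimately obtain \<F> where "finite \<F>" "\<F> \<subseteq> U ` A" "topspace X \<subseteq> \<Union>\<F>"
      using cX unfolding compact_space_alt by (metis (no_types, lifting) imageE)
    then obtain B where B: "finite B" "B \<subseteq> A" "topspace X \<subseteq> \<Union>(U ` B)"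
      by (metis finite_subset_image)
    have "\<exists>g\<in>B. \<forall>i<n. \<bar>g (t i) - f (t i)\<bar> < 1 / real (Suc n)"
      if "t \<in> {..<n} \<rightarrow>\<^sub>E topspace K" for t
    proof -
      have "t \<in> topspace X" using that by (simp add: X_def)
      then obtain g where "g \<in> B" "t \<in> U g" using B by blast
      then show ?thesis by (auto simp: U_def intro!: bexI[of _ g])
    qed
    then show ?thesis using B by blast
  qed
  then obtain B where B: "\<And>n. finite (B n)" "\<And>n. B n \<subseteq> A"
    "\<And>n t. t \<in> {..<n} \<rightarrow>\<^sub>E topspace K \<Longrightarrow> \<exists>g\<in>B n. \<forall>i<n. \<bar>g (t i) - f (t i)\<bar> < 1 / real (Suc n)"
    by metis
  show thesis
  proof
    show "countable (\<Union>n. B n)" using B(1) by (auto intro: countable_finite)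
    show BA: "(\<Union>n. B n) \<subseteq> A" using B(2) by auto
    have "\<exists>g\<in>\<Union>n. B n. \<forall>x\<in>S. \<bar>g x - f x\<bar> < e" if S: "finite S" "S \<subseteq> topspace K" and e: "e > 0" for S e
    \<comment> \<open>With no points to test it is enough that \<open>B 0\<close> is nonempty, which
      follows from the only 0-tuple, constantly \<open>undefined\<close>.\<close>
    proof (cases "S = {}")
      case True
      show ?thesis
        using B(3)[of "\<lambda>_. undefined" 0] True by auto
    next
      case False
      obtain m where m: "1 / real (Suc m) < e" using e nat_approx_posE by blast
      \<comment> \<open>Large enough both for the accuracy and for a tuple listing all of
        \<open>S\<close>; surplus coordinates repeat \<open>z\<close>.\<close>
      define n where "n = max m (card S)"
      obtain h where h: "bij_betw h {..<card S} S"
        using S(1) ex_bij_betw_nat_finite atLeast0LessThan by metis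
      obtain z where z: "z \<in> S" using False by blast
      define t where "t = (\<lambda>i\<in>{..<n}. if i < card S then h i else z)"
      have "h i \<in> topspace K" if "i < card S" for i
        using bij_betwE[OF h] that S(2) by auto
      moreover have "z \<in> topspace K" using z S(2) by blast
      ultimately have "t \<in> {..<n} \<rightarrow>\<^sub>E topspace K"
        by (auto simp: t_def)
      then obtain g where g: "g \<in> B n" "\<And>i. i < n \<Longrightarrow> \<bar>g (t i) - f (t i)\<bar> < 1 / real (Suc n)"
        using B(3) by blast
      have "\<bar>g x - f x\<bar> < e" if "x \<in> S" for x
      proof -
        obtain i where "i < card S" "h i = x" using bij_betw_imp_surj_on[OF h] \<open>x \<in> S\<close> by (metis imageE lessThan_iff)
        then have "\<bar>g x - f x\<bar> < 1 / real (Suc n)" using g(2)[of i] by (simp add: t_def n_def)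
        also have "\<dots> \<le> 1 / real (Suc m)" by (intro divide_left_mono) (auto simp: n_def)
        finally show ?thesis using m by linarith
      qed
      then show ?thesis using g(1) by blast
    qed
    then show "f \<in> Cp K closure_of (\<Union>n. B n)"
      using in_closure_of_Cp_iff[OF fC subset_trans[OF BA A]] by blast
  qed
qed

text \<open>By compactness it suffices that every point has a neighbourhood with countable image. A point
  \<open>x\<close> isolated in the set \<open>K - W\<close> of exceptions would have such a neighbourhood too: the
  part of it where the image differs from that of \<open>x\<close> is a countable union of compact subsets
  of \<open>W\<close>.\<close>

lemma countable_image_scattered:
  fixes g :: "nat \<Rightarrow> 'a \<Rightarrow> real"
  assumes K: "compact_space K" "Hausdorff_space K" and sc: "scattered_space K"
    and g: "\<And>n. continuous_map K euclideanreal (g n)"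
  shows "countable ((\<lambda>x n. g n x) ` topspace K)"
proof -
  define \<Phi> where "\<Phi> = (\<lambda>x n. g n x)"
  define W where "W = {x \<in> topspace K. \<exists>U. openin K U \<and> x \<in> U \<and> countable (\<Phi> ` U)}"
  have cW: "countable (\<Phi> ` C)" if "compactin K C" "C \<subseteq> W" for C
  proof -
    have "\<exists>U. openin K U \<and> x \<in> U \<and> countable (\<Phi> ` U)" if "x \<in> C" for x
      using that \<open>C \<subseteq> W\<close> by (auto simp: W_def)
    then obtain U where U: "\<And>x. x \<in> C \<Longrightarrow> openin K (U x) \<and> x \<in> U x \<and> countable (\<Phi> ` U x)"
      by metis
    then have "(\<forall>V\<in>U ` C. openin K V) \<and> C \<subseteq> \<Union>(U ` C)" by blast
    then obtain \<F> where "finite \<F>" "\<F> \<subseteq> U ` C" "C \<subseteq> \<Union>\<F>"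
      using \<open>compactin K C\<close> unfolding compactin_def by meson
    then obtain D where D: "finite D" "D \<subseteq> C" "C \<subseteq> \<Union>(U ` D)"
      by (metis finite_subset_image)
    have "countable (\<Union>x\<in>D. \<Phi> ` U x)"
      using D U by (intro countable_UN) (auto intro: countable_finite)
    moreover have "\<Phi> ` C \<subseteq> (\<Union>x\<in>D. \<Phi> ` U x)" using D(3) by blast
    ultimately show ?thesis by (rule countable_subset[rotated])
  qed
  have "topspace K - W = {}"
  proof (rule ccontr)
    assume "topspace K - W \<noteq> {}"
    then have "\<not> topspace K - W \<subseteq> K derived_set_of (topspace K - W)"
      using sc by (auto simp: scattered_space_def dense_in_itself_def)
    then obtain x T where x: "x \<in> topspace K" "x \<notin> W" and T: "openin K T" "x \<in> T"
      and iso: "\<not> (\<exists>y\<noteq>x. y \<in> topspace K - W \<and> y \<in> T)"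
      unfolding in_derived_set_of subset_iff by blast
    have T': "T - {x} \<subseteq> W" using iso openin_subset[OF T(1)] by blast
    \<comment> \<open>A closed neighbourhood inside \<open>T\<close> makes the sets
      \<open>D n m\<close> below compact.\<close>
    have "neighbourhood_base_of (closedin K) K"
      using K by (simp add: neighbourhood_base_of_closedin compact_Hausdorff_imp_regular_space)
    then obtain U C where UC: "openin K U" "closedin K C" "x \<in> U" "U \<subseteq> C" "C \<subseteq> T"
      using T unfolding neighbourhood_base_of by metis
    \<comment> \<open>The weak inequality makes \<open>D n m\<close> closed and still excludes
      \<open>x\<close>, so \<open>D n m\<close> lies in \<open>T - {x}\<close> and hence in
      \<open>W\<close>.\<close>
    define D where "D n m = C \<inter> {y \<in> topspace K. g n y - g n x \<in> {t. \<bar>t\<bar> \<ge> 1 / real (Suc m)}}" for n m :: nat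
    have "closedin K (D n m)" for n m
    proof -
      have "closed {t::real. \<bar>t\<bar> \<ge> 1 / real (Suc m)}"
        by (intro closed_Collect_le continuous_intros)
      then show ?thesis
        unfolding D_def
        by (intro closedin_Int UC closedin_continuous_map_preimage[where Y=euclideanreal] continuous_intros g) auto
    qed
    then have "compactin K (D n m)" for n m by (simp add: K closedin_compact_space)
    moreover have "D n m \<subseteq> W" for n m
    proof -
      have "x \<notin> D n m" by (simp add: D_def)
      then show ?thesis using UC T' by (auto simp: D_def)
    qed
    ultimately have "countable (\<Phi> ` D n m)" for n m by (rule cW)
    then have "countable (insert (\<Phi> x) (\<Union>n m. \<Phi> ` D n m))" by simp
    moreover have "\<Phi> ` U \<subseteq> insert (\<Phi> x) (\<Union>n m. \<Phi> ` D n m)"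
    proof
      fix z assume "z \<in> \<Phi> ` U"
      then obtain y where y: "y \<in> U" "z = \<Phi> y" by blast
      show "z \<in> insert (\<Phi> x) (\<Union>n m. \<Phi> ` D n m)"
      proof (cases "z = \<Phi> x")
        case False
        then obtain n where "g n y \<noteq> g n x" using y by (auto simp: \<Phi>_def)
        then have "\<bar>g n y - g n x\<bar> > 0" by simp
        then obtain m where "1 / real (Suc m) < \<bar>g n y - g n x\<bar>" using nat_approx_posE by blast
        then have "y \<in> D n m" using y UC openin_subset[of K U] by (auto simp: D_def)
        then show ?thesis using y by blast
      qed auto
    qed
    ultimately have "countable (\<Phi> ` U)" by (rule countable_subset[rotated])
    then show False using x UC by (auto simp: W_def)
  qed
  then have "topspace K \<subseteq> W" by blast
  then show ?thesis
    using cW[of "topspace K"] K by (simp add: compact_space_def \<Phi>_def)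
qed

text \<open>Tightness replaces \<open>A\<close> by a countable \<open>B\<close>. The members of
  \<open>B\<close> and \<open>f\<close> are constant on the countably many fibres of
  \<open>\<Phi>\<close>. Approximating \<open>f\<close> at the first \<open>n\<close>
  representatives within 1/(n+1) then gives convergence at every point.\<close>

lemma frechet_urysohn_Cp_if_scattered:
  assumes K: "compact_space K" "Hausdorff_space K" and sc: "scattered_space K"
  shows "frechet_urysohn_space (Cp K)"
  unfolding frechet_urysohn_space_def
proof (intro allI impI, elim conjE)
  fix A f assume A: "A \<subseteq> topspace (Cp K)" and f: "f \<in> Cp K closure_of A"
  have fC: "f \<in> topspace (Cp K)" using f by (meson closure_of_subset_topspace subsetD)
  obtain B where B: "countable B" "B \<subseteq> A" and fB: "f \<in> Cp K closure_of B"
    using countable_tightness_Cp[OF K(1) A f] .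
  have BC: "B \<subseteq> topspace (Cp K)" using A B by blast
  \<comment> \<open>\<open>f\<close> is enumerated too, since the limit must also be constant on the
    fibres.\<close>
  define G where "G = from_nat_into (insert f B)"
  have rG: "range G = insert f B" unfolding G_def using B by (intro range_from_nat_into) auto
  have G: "continuous_map K euclideanreal (G n)" for n
    using rG fC BC by (auto simp: topspace_Cp)
  define \<Phi> where "\<Phi> = (\<lambda>x n. G n x)"
  have ct: "countable (\<Phi> ` topspace K)"
    using countable_image_scattered[OF K sc G] by (simp add: \<Phi>_def)
  obtain D where D: "D \<subseteq> topspace K" "countable D" "\<Phi> ` D = \<Phi> ` topspace K"
    using ct by (metis countable_subset_image subset_refl)
  define d where "d = from_nat_into D"
  \<comment> \<open>If \<open>D\<close> is empty, the values of \<open>d\<close> may lie outside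
    \<open>K\<close>; hence the guard here and below.\<close>
  have dD: "d ` {..<n} \<subseteq> topspace K" if "D \<noteq> {}" for n
    using D(1) from_nat_into[OF that] by (auto simp: d_def)
  have "\<exists>h\<in>B. D \<noteq> {} \<longrightarrow> (\<forall>i<n. \<bar>h (d i) - f (d i)\<bar> < 1 / real (Suc n))" for n
  proof (cases "D = {}")
    case True
    have "B \<noteq> {}" using fB by auto
    then show ?thesis using True by blast
  next
    case False
    from in_closure_of_Cp_iff[OF fC BC] fB have
      "\<exists>h\<in>B. \<forall>x\<in>d ` {..<n}. \<bar>h x - f x\<bar> < 1 / real (Suc n)"
      using dD[OF False] by (metis finite_imageI finite_lessThan of_nat_0_less_iff zero_less_Suc zero_less_divide_1_iff)
    then show ?thesis by auto
  qed
  then obtain s where s: "\<And>n. s n \<in> B"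
    "\<And>n i. \<lbrakk>D \<noteq> {}; i < n\<rbrakk> \<Longrightarrow> \<bar>s n (d i) - f (d i)\<bar> < 1 / real (Suc n)" by metis
  have "(\<lambda>n. s n x) \<longlonglongrightarrow> f x" if x: "x \<in> topspace K" for x
  proof -
    obtain y where y: "y \<in> D" "\<Phi> y = \<Phi> x" using D(3) x by (metis imageE imageI)
    then have eq: "h y = h x" if "h \<in> insert f B" for h
      using that rG by (metis \<Phi>_def imageE)
    obtain i where i: "y = d i" using y D(2) unfolding d_def by (metis from_nat_into_to_nat_on)
    have "(\<lambda>n. s n y) \<longlonglongrightarrow> f y"
    proof (rule Lim_transform_bound[OF _ LIMSEQ_inverse_real_of_nat, THEN LIM_zero_cancel])
      show "\<forall>\<^sub>F n in sequentially. norm (s n y - f y) \<le> norm (inverse (real (Suc n)))"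
        using eventually_gt_at_top[of i]
      proof eventually_elim
        case (elim n)
        have "D \<noteq> {}" using y(1) by blast
        from s(2)[OF this elim] show ?case by (simp add: i inverse_eq_divide)
      qed
    qed
    moreover have "s n y = s n x" for n using eq s(1) by blast
    moreover have "f y = f x" using eq by blast
    ultimately show ?thesis by simp
  qed
  then have "limitin (Cp K) s f sequentially"
    using limitin_Cp_iff[OF fC, of s] s(1) BC by blast
  then show "\<exists>s. range s \<subseteq> A \<and> limitin (Cp K) s f sequentially"
    using s(1) B(2) by blast
qed

section \<open>The property (B)\<close>

text \<open>Take \<open>q n\<close> converging to \<open>p\<close> and, near each \<open>q n\<close>
  but apart from \<open>p\<close>, the set \<open>D n\<close> missing the first members of the
  cover. A sequence from the union of the \<open>D n\<close> converging to \<open>p\<close> must use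
  arbitrarily large \<open>n\<close>. With its limit it is compact, yet no \<open>A m\<close>
  contains it.\<close>

lemma frechet_urysohn_imp_not_property_B:
  assumes H: "Hausdorff_space X" and ne: "topspace X \<noteq> {}" and FU: "frechet_urysohn_space X"
  shows "\<not> property_B X"
proof
  assume "property_B X"
  then obtain A where clA: "\<And>n::nat. closedin X (A n)" and nd: "\<And>n. nowhere_dense_in X (A n)"
    and cov: "topspace X = (\<Union>n. A n)"
    and cpt: "\<And>C. compactin X C \<Longrightarrow> \<exists>n. C \<subseteq> A n"
    unfolding property_B_def by metis
  have int: "X interior_of (A n) = {}" for n
    using nd[of n] clA[of n] by (simp add: nowhere_dense_in_def closure_of_closedin)
  \<comment> \<open>Finite unions make the cover increasing, so avoiding \<open>B n\<close> avoids
    \<open>A 0\<close> to \<open>A n\<close> at once; the interiors remain empty because the sets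
    are closed.\<close>
  define B where "B n = (\<Union>i\<le>n. A i)" for n
  have clB: "closedin X (B n)" for n unfolding B_def using clA by (intro closedin_Union) auto
  have intB: "X interior_of (B n) = {}" for n
  proof (induction n)
    case 0 then show ?case using int by (simp add: B_def)
  next
    case (Suc n)
    have "B (Suc n) = B n \<union> A (Suc n)" by (auto simp: B_def le_Suc_eq)
    then show ?case using Suc int clA clB
      by (metis interior_of_union_eq_empty)
  qed
  obtain p where p: "p \<in> topspace X" using ne by blast
  have seq: "\<exists>s::nat \<Rightarrow> 'a. range s \<subseteq> S \<and> limitin X s x sequentially"
    if "S \<subseteq> topspace X" "x \<in> X closure_of S" for S x
    using FU that unfolding frechet_urysohn_space_def by blast
  have dense: "\<exists>y\<in>U. y \<notin> B n" if "openin X U" "U \<noteq> {}" for U n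
    using intB[of n] that interior_of_maximal[of U "B n" X] by blast
  \<comment> \<open>\<open>p\<close> is not isolated: it lies in some \<open>B n\<close>, which
    contains no nonempty open set.\<close>
  have "p \<in> X closure_of (topspace X - {p})"
  proof -
    obtain n where "p \<in> A n" using p cov by blast
    show ?thesis
      unfolding in_closure_of
    proof (intro conjI p allI impI)
      fix T assume T: "p \<in> T \<and> openin X T"
      then obtain y where "y \<in> T" "y \<notin> B n" using dense[of T n] by blast
      moreover have "p \<in> B n" using \<open>p \<in> A n\<close> by (auto simp: B_def)
      ultimately show "\<exists>y. y \<in> topspace X - {p} \<and> y \<in> T"
        using T openin_subset by fastforce
    qed
  qed
  then obtain q where q: "\<And>n::nat. q n \<in> topspace X - {p}" and qlim: "limitin X q p sequentially"
    using seq[of "topspace X - {p}" p] by blast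
  have "\<exists>U V. openin X U \<and> openin X V \<and> p \<in> U \<and> q n \<in> V \<and> disjnt U V" for n
    using H p q[of n] unfolding Hausdorff_space_def by (metis DiffE insertCI)
  then obtain U V where UV: "\<And>n. openin X (U n)" "\<And>n. openin X (V n)" "\<And>n. p \<in> U n"
    "\<And>n. q n \<in> V n" "\<And>n. disjnt (U n) (V n)"
    by metis
  define D where "D n = V n - B n" for n
  have "p \<in> X closure_of (\<Union>n. D n)"
    unfolding in_closure_of
  proof (intro conjI p allI impI)
    fix T assume T: "p \<in> T \<and> openin X T"
    then obtain n where n: "q n \<in> T" using qlim unfolding limitin_sequentially by blast
    have "openin X (T \<inter> V n)" "T \<inter> V n \<noteq> {}" using T UV n by blast+
    then obtain y where "y \<in> T \<inter> V n" "y \<notin> B n" using dense by blast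
    then show "\<exists>y. y \<in> (\<Union>n. D n) \<and> y \<in> T" by (auto simp: D_def)
  qed
  moreover have DX: "(\<Union>n. D n) \<subseteq> topspace X" using UV(2) openin_subset by (fastforce simp: D_def)
  ultimately obtain s where s: "\<And>k::nat. s k \<in> (\<Union>n. D n)" and slim: "limitin X s p sequentially"
    using seq[of "\<Union>n. D n" p] by blast
  have "compactin X (insert p (range s))"
    using compactin_sequence_with_limit[OF slim] s DX by blast
  then obtain m where m: "insert p (range s) \<subseteq> A m" using cpt by blast
  \<comment> \<open>This neighbourhood of \<open>p\<close> misses \<open>D 0\<close> to
    \<open>D m\<close>, so a term \<open>s k\<close> in it comes from some \<open>D n\<close> with
    \<open>n > m\<close>.\<close>
  have "openin X (\<Inter>n\<le>m. U n)" by (intro openin_Inter) (auto simp: UV(1))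
  then obtain k where k: "s k \<in> (\<Inter>n\<le>m. U n)"
    using slim UV(3) unfolding limitin_sequentially
    by (metis (no_types, lifting) INT_I order_refl)
  obtain n where n: "s k \<in> D n" using s by blast
  then have "\<not> n \<le> m" using k UV(5)[of n] by (auto simp: D_def disjnt_iff)
  then have "m \<in> {..n}" by simp
  then have "A m \<subseteq> B n" unfolding B_def by blast
  then show False using m n by (auto simp: D_def)
qed

section \<open>Cantor schemes and infinite traces\<close>

text \<open>A binary tree of closed sets is grown over a dense-in-itself set \<open>A\<close>: two
  points of \<open>A\<close> inside a node are separated by the Hausdorff property, and regularity
  supplies closed children around them.\<close>

lemma countable_splitting_family:
  assumes K: "compact_space K" "Hausdorff_space K" and nsc: "\<not> scattered_space K"
  obtains \<P> where "countable \<P>" "\<P> \<noteq> {}" "\<And>P. P \<in> \<P> \<Longrightarrow> closedin K P \<and> P \<noteq> {}"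
    "\<And>P. P \<in> \<P> \<Longrightarrow> \<exists>Q\<in>\<P>. \<exists>R\<in>\<P>. Q \<subseteq> P \<and> R \<subseteq> P \<and> disjnt Q R"
proof -
  obtain A where A: "A \<subseteq> topspace K" "A \<noteq> {}" "A \<subseteq> K derived_set_of A"
    using nsc by (auto simp: scattered_space_def dense_in_itself_def)
  \<comment> \<open>Asking for a point of \<open>A\<close> in an open subset lets the splitting
    repeat: a second point of \<open>A\<close> always lies in that open set.\<close>
  define good where "good P \<longleftrightarrow> closedin K P \<and> (\<exists>U a. openin K U \<and> a \<in> U \<and> a \<in> A \<and> U \<subseteq> P)" for P
  have nb: "\<exists>P. good P \<and> P \<subseteq> W" if "openin K W" "a \<in> W" "a \<in> A" for W a
  proof -
    have "neighbourhood_base_of (closedin K) K"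
      using K by (simp add: neighbourhood_base_of_closedin compact_Hausdorff_imp_regular_space)
    then show ?thesis using that unfolding neighbourhood_base_of good_def by metis
  qed
  have split: "\<exists>Q R. good Q \<and> good R \<and> Q \<subseteq> P \<and> R \<subseteq> P \<and> disjnt Q R" if P: "good P" for P
  proof -
    obtain U a where U: "openin K U" "a \<in> U" "a \<in> A" "U \<subseteq> P" using P by (auto simp: good_def)
    have "a \<in> K derived_set_of A" using U A by blast
    then obtain b where b: "b \<noteq> a" "b \<in> A" "b \<in> U" using U by (auto simp: in_derived_set_of)
    obtain V W where VW: "openin K V" "openin K W" "a \<in> V" "b \<in> W" "disjnt V W"
      using K(2) b U A unfolding Hausdorff_space_def by (metis subsetD)
    have "openin K (U \<inter> V)" "openin K (U \<inter> W)" using U VW by auto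
    then obtain Q R where "good Q" "Q \<subseteq> U \<inter> V" "good R" "R \<subseteq> U \<inter> W"
      using nb[of "U \<inter> V" a] nb[of "U \<inter> W" b] U VW b by blast
    then show ?thesis using U(4) VW(5) by (intro exI[of _ Q] exI[of _ R]) (auto simp: disjnt_iff)
  qed
  obtain l r where lr: "\<And>P. good P \<Longrightarrow> good (l P) \<and> good (r P) \<and> l P \<subseteq> P \<and> r P \<subseteq> P \<and> disjnt (l P) (r P)"
    using split by metis
  \<comment> \<open>The head of the list is the last choice made, so prefixing a bit passes to a
    child.\<close>
  define node where "node bs = foldr (\<lambda>b P. if b then l P else r P) bs (topspace K)" for bs
  have gt: "good (topspace K)" using A unfolding good_def by blast
  have gn: "good (node bs)" for bs
    by (induction bs) (use gt lr in \<open>auto simp: node_def\<close>)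
  show thesis
  proof
    show "countable (range node)" "range node \<noteq> {}" by auto
    show "closedin K P \<and> P \<noteq> {}" if "P \<in> range node" for P
      using gn that by (auto simp: good_def)
    show "\<exists>Q\<in>range node. \<exists>R\<in>range node. Q \<subseteq> P \<and> R \<subseteq> P \<and> disjnt Q R" if "P \<in> range node" for P
    proof -
      obtain bs where bs: "P = node bs" using \<open>P \<in> range node\<close> by blast
      have "node (True # bs) = l P" "node (False # bs) = r P" by (simp_all add: bs node_def)
      then show ?thesis using lr[OF gn[of bs]] bs by (metis rangeI)
    qed
  qed
qed

text \<open>The complement of \<open>V\<close> is a minimal closed set meeting all members of \<open>\<P>\<close>. Open sets
  fit Zorn's lemma, since a compact set covered by a chain of open sets lies in one of them.\<close>

lemma maximal_open_containing_no_compact: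
  assumes "\<And>P. P \<in> \<P> \<Longrightarrow> compactin X P \<and> P \<noteq> {}"
  obtains V where "openin X V" "\<And>P. P \<in> \<P> \<Longrightarrow> \<not> P \<subseteq> V"
    "\<And>U. \<lbrakk>openin X U; V \<subset> U\<rbrakk> \<Longrightarrow> \<exists>P\<in>\<P>. P \<subseteq> U"
proof -
  define \<V> where "\<V> = {V. openin X V \<and> (\<forall>P\<in>\<P>. \<not> P \<subseteq> V)}"
  have "\<exists>M\<in>\<V>. \<forall>U\<in>\<V>. M \<subseteq> U \<longrightarrow> U = M"
  proof (rule subset_Zorn_nonempty)
    have "{} \<in> \<V>" using assms by (auto simp: \<V>_def)
    then show "\<V> \<noteq> {}" by blast
    fix \<C> assume "\<C> \<noteq> {}" and ch: "subset.chain \<V> \<C>"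
    have sub: "\<C> \<subseteq> \<V>" using ch by (simp add: subset_chain_def)
    have "\<not> P \<subseteq> \<Union>\<C>" if P: "P \<in> \<P>" for P
    proof
      assume "P \<subseteq> \<Union>\<C>"
      moreover have "\<forall>V\<in>\<C>. openin X V" using sub by (auto simp: \<V>_def)
      ultimately obtain \<F> where \<F>: "finite \<F>" "\<F> \<subseteq> \<C>" "P \<subseteq> \<Union>\<F>"
        using assms[OF P] unfolding compactin_def by meson
      have "\<F> \<noteq> {}" using \<F>(3) assms[OF P] by blast
      moreover have "subset.chain \<V> \<F>"
        using \<F>(2) ch unfolding subset_chain_def by (meson subsetD subset_trans)
      ultimately have "\<Union>\<F> \<in> \<F>" using Union_in_chain[OF \<F>(1)] by blast
      then have "\<Union>\<F> \<in> \<V>" using \<F>(2) sub by (meson subsetD)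
      then show False using \<F>(3) P by (simp add: \<V>_def)
    qed
    then show "\<Union>\<C> \<in> \<V>" using sub by (auto simp: \<V>_def)
  qed
  then obtain V where V: "V \<in> \<V>" and max: "\<And>U. \<lbrakk>U \<in> \<V>; V \<subseteq> U\<rbrakk> \<Longrightarrow> U = V" by blast
  show thesis
  proof
    show "openin X V" "\<And>P. P \<in> \<P> \<Longrightarrow> \<not> P \<subseteq> V" using V by (auto simp: \<V>_def)
    show "\<exists>P\<in>\<P>. P \<subseteq> U" if "openin X U" "V \<subset> U" for U
      using max[of U] that by (auto simp: \<V>_def)
  qed
qed

text \<open>By descent: of two disjoint members inside \<open>P\<close>, one has a point outside
  \<open>V\<close>, so the other leaves a strictly smaller difference.\<close>

lemma infinite_Diff_splitting_family:
  assumes split: "\<And>P. P \<in> \<P> \<Longrightarrow> \<exists>Q\<in>\<P>. \<exists>R\<in>\<P>. Q \<subseteq> P \<and> R \<subseteq> P \<and> disjnt Q R"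
    and V: "\<And>P. P \<in> \<P> \<Longrightarrow> \<not> P \<subseteq> V" and "P \<in> \<P>"
  shows "infinite (P - V)"
proof
  assume "finite (P - V)"
  then show False using \<open>P \<in> \<P>\<close>
  proof (induction "P - V" arbitrary: P rule: finite_psubset_induct)
    case psubset
    obtain Q R where QR: "Q \<in> \<P>" "R \<in> \<P>" "Q \<subseteq> P" "R \<subseteq> P" "disjnt Q R"
      using split[OF psubset.prems] by blast
    then have "Q - V \<subset> P - V" using V[of R] by (auto simp: disjnt_iff)
    then show False using psubset.hyps QR(1) by blast
  qed
qed

section \<open>Sets of functions bounded on a fixed set\<close>

lemma closedin_Cp_bounded_on:
  assumes "S \<subseteq> topspace K"
  shows "closedin (Cp K) {f \<in> topspace (Cp K). \<forall>x\<in>S. \<bar>f x\<bar> \<le> c}"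
proof -
  have "closedin (Cp K) {f \<in> topspace (Cp K). f x \<in> {t. \<bar>t\<bar> \<le> c}}" if "x \<in> S" for x
  proof -
    have "closed {t::real. \<bar>t\<bar> \<le> c}" by (intro closed_Collect_le continuous_intros)
    then show ?thesis
      using that assms by (intro closedin_continuous_map_preimage[OF continuous_map_Cp_eval]) auto
  qed
  moreover have "{f \<in> topspace (Cp K). \<forall>x\<in>S. \<bar>f x\<bar> \<le> c} =
      topspace (Cp K) \<inter> \<Inter>((\<lambda>x. {f \<in> topspace (Cp K). f x \<in> {t. \<bar>t\<bar> \<le> c}}) ` S)"
    by auto
  ultimately show ?thesis
    by (cases "S = {}") (auto intro!: closedin_Int closedin_Inter)
qed

text \<open>A basic neighbourhood controls values on a finite \<open>F\<close> only. Complete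
  regularity allows a change at a point of \<open>S\<close> outside \<open>F\<close> that breaks the
  bound and leaves \<open>F\<close> untouched.\<close>

lemma nowhere_dense_Cp_bounded_on:
  assumes K: "compact_space K" "Hausdorff_space K" and S: "S \<subseteq> topspace K" "infinite S"
  shows "nowhere_dense_in (Cp K) {f \<in> topspace (Cp K). \<forall>x\<in>S. \<bar>f x\<bar> \<le> c}" (is "nowhere_dense_in _ ?A")
proof -
  have "Cp K interior_of ?A = {}"
  proof (rule ccontr)
    assume "Cp K interior_of ?A \<noteq> {}"
    then obtain f where f: "f \<in> Cp K interior_of ?A" by blast
    then have fC: "f \<in> topspace (Cp K)" using interior_of_subset_topspace by fastforce
    obtain F e where F: "finite F" "F \<subseteq> topspace K" "e > 0"
      and nb: "\<forall>g\<in>topspace (Cp K). (\<forall>x\<in>F. \<bar>g x - f x\<bar> < e) \<longrightarrow> g \<in> Cp K interior_of ?A"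
      by (rule openin_Cp_basic[OF openin_interior_of f])
    obtain y where y: "y \<in> S" "y \<notin> F" using S(2) F(1) by (meson finite_subset subsetI)
    have "completely_regular_space K"
      using K by (simp add: normal_imp_completely_regular_space compact_Hausdorff_or_regular_imp_normal_space)
    moreover have "closedin K F"
      using F K by (simp add: closedin_Hausdorff_finite)
    ultimately obtain h where h: "continuous_map K euclideanreal h" "h y = 0" "h ` F \<subseteq> {1}"
      using y S unfolding completely_regular_space_alt by (meson DiffI subsetD)
    \<comment> \<open>The added term vanishes on \<open>F\<close>, where \<open>h\<close> is 1, and
      raises the value at \<open>y\<close>, where \<open>h\<close> is 0, to
      \<open>\<bar>c\<bar> + 1\<close>.\<close>
    define g where "g = restrict (\<lambda>x. f x + (\<bar>c\<bar> + 1 - f y) * (1 - h x)) (topspace K)"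
    have gC: "g \<in> topspace (Cp K)"
      unfolding g_def
      by (intro restrict_in_Cp continuous_intros h) (use fC in \<open>auto simp: topspace_Cp\<close>)
    have "g x = f x" if "x \<in> F" for x using that h F by (auto simp: g_def)
    then have "g \<in> Cp K interior_of ?A" using nb gC F(3) by simp
    then have "g \<in> ?A" by (rule subsetD[OF interior_of_subset])
    then have "\<bar>g y\<bar> \<le> c" using y(1) by blast
    moreover have "g y = \<bar>c\<bar> + 1" using subsetD[OF S(1) y(1)] h(2) by (simp add: g_def)
    ultimately show False by linarith
  qed
  then show ?thesis
    using closedin_Cp_bounded_on[OF S(1)]
    by (auto simp: nowhere_dense_in_def closure_of_closedin)
qed

section \<open>Property (B) over non-scattered spaces\<close>

lemma property_B_Cp_if_not_scattered:
  assumes K: "compact_space K" "Hausdorff_space K" and nsc: "\<not> scattered_space K"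
  shows "property_B (Cp K)"
proof -
  obtain \<P> where c\<P>: "countable \<P>" and ne\<P>: "\<P> \<noteq> {}"
    and clo: "\<And>P. P \<in> \<P> \<Longrightarrow> closedin K P \<and> P \<noteq> {}"
    and split: "\<And>P. P \<in> \<P> \<Longrightarrow> \<exists>Q\<in>\<P>. \<exists>R\<in>\<P>. Q \<subseteq> P \<and> R \<subseteq> P \<and> disjnt Q R"
    using countable_splitting_family[OF assms] by metis
  have "compactin K P \<and> P \<noteq> {}" if "P \<in> \<P>" for P
    using clo[OF that] K by (simp add: closedin_compact_space)
  then obtain V where V: "openin K V" "\<And>P. P \<in> \<P> \<Longrightarrow> \<not> P \<subseteq> V"
    and max: "\<And>U. \<lbrakk>openin K U; V \<subset> U\<rbrakk> \<Longrightarrow> \<exists>P\<in>\<P>. P \<subseteq> U"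
    using maximal_open_containing_no_compact[of \<P> K] by metis
  have inf: "infinite (P - V)" and PK: "P - V \<subseteq> topspace K" if "P \<in> \<P>" for P
    using infinite_Diff_splitting_family[OF split V(2) that] clo[OF that] closedin_subset by auto
  define A where "A P m = {f \<in> topspace (Cp K). \<forall>x\<in>P - V. \<bar>f x\<bar> \<le> real m}" for P and m :: nat
  define L where "L = topspace K - V"
  define X where "X = subtopology K L"
  have clL: "closedin K L" using V(1) by (auto simp: L_def)
  have tX: "topspace X = L" by (auto simp: X_def L_def)
  obtain P0 where "P0 \<in> \<P>" using ne\<P> by blast
  then have neL: "L \<noteq> {}" using V(2) PK unfolding L_def by blast
  have cX: "compact_space X"
    unfolding X_def using clL K by (simp add: closedin_compact_space compact_space_subtopology)
  have rX: "regular_space X"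
    using cX K(2) unfolding X_def
    by (intro compact_Hausdorff_imp_regular_space Hausdorff_space_subtopology) auto
  have swallow: "\<exists>P\<in>\<P>. \<exists>m. C \<subseteq> A P m" if C: "compactin (Cp K) C" for C
  proof -
    have CC: "C \<subseteq> topspace (Cp K)" using C by (simp add: compactin_subset_topspace)
    \<comment> \<open>Evaluation at a point maps the compact \<open>C\<close> to a bounded set of
      reals, so the closed sets \<open>F m\<close> cover \<open>L\<close>.\<close>
    define F where "F m = {x \<in> L. \<forall>f\<in>C. \<bar>f x\<bar> \<le> real m}" for m :: nat
    have clF: "closedin X (F m)" for m
    proof -
      have "closedin X {x \<in> topspace X. f x \<in> {t. \<bar>t\<bar> \<le> real m}}" if "f \<in> C" for f
      proof (rule closedin_continuous_map_preimage)
        show "continuous_map X euclideanreal f"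
          using that CC by (auto simp: X_def topspace_Cp intro: continuous_map_from_subtopology)
        show "closedin euclideanreal {t::real. \<bar>t\<bar> \<le> real m}"
          by simp (intro closed_Collect_le continuous_intros)
      qed
      moreover have "F m = topspace X \<inter> \<Inter>((\<lambda>f. {x \<in> topspace X. f x \<in> {t. \<bar>t\<bar> \<le> real m}}) ` C)"
        by (auto simp: F_def tX)
      ultimately show ?thesis
        by (cases "C = {}") (auto intro!: closedin_Int closedin_Inter)
    qed
    have cov: "\<Union>(range F) = L"
    proof -
      have "\<exists>m. x \<in> F m" if "x \<in> L" for x
      proof -
        have "compactin euclideanreal ((\<lambda>f. f x) ` C)"
          using that C by (intro image_compactin[OF C continuous_map_Cp_eval]) (auto simp: L_def)
        then have "bounded ((\<lambda>f. f x) ` C)" by (simp add: compact_imp_bounded)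
        then obtain b where b: "\<And>f. f \<in> C \<Longrightarrow> \<bar>f x\<bar> \<le> b" by (auto simp: bounded_iff)
        obtain m where "b \<le> real m" using real_arch_simple by blast
        then have "x \<in> F m" using b that by (force simp: F_def)
        then show ?thesis ..
      qed
      then show ?thesis by (auto simp: F_def)
    qed
    \<comment> \<open>Baire category in the nonempty compact Hausdorff space
      \<open>X\<close>.\<close>
    have "\<exists>m. X interior_of F m \<noteq> {}"
    proof (rule ccontr)
      assume "\<not> (\<exists>m. X interior_of F m \<noteq> {})"
      then have "X interior_of \<Union>(range F) = {}"
        using clF cX rX by (intro Baire_category_alt) (auto intro: compact_imp_locally_compact_space)
      then show False using cov neL tX by (metis interior_of_topspace)
    qed
    then obtain m where m: "X interior_of F m \<noteq> {}" by blast
    obtain T where T: "openin K T" "X interior_of F m = T \<inter> L"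
      using openin_interior_of[of X "F m"] unfolding X_def openin_subtopology by blast
    have TF: "T \<inter> L \<subseteq> F m" using T(2) interior_of_subset by metis
    \<comment> \<open>\<open>T\<close> meets the complement \<open>L\<close> of \<open>V\<close>, so
      by maximality \<open>V \<union> T\<close> contains some \<open>P\<close>, whose trace
      \<open>P - V\<close> then lies in \<open>T \<inter> L\<close>.\<close>
    have "V \<subset> V \<union> T" using m T(2) by (auto simp: L_def)
    then obtain P where P: "P \<in> \<P>" "P \<subseteq> V \<union> T" using max[of "V \<union> T"] V(1) T(1) by blast
    have "P - V \<subseteq> F m" using P PK[OF P(1)] TF unfolding L_def by blast
    then have "C \<subseteq> A P m" using CC by (auto simp: A_def F_def)
    then show ?thesis using P(1) by blast
  qed
  define \<A> where "\<A> = (\<lambda>(P, m). A P m) ` (\<P> \<times> UNIV)"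
  have c\<A>: "countable \<A>" "\<A> \<noteq> {}" using c\<P> ne\<P> by (auto simp: \<A>_def)
  define E where "E = from_nat_into \<A>"
  have rE: "range E = \<A>" unfolding E_def using c\<A> by simp
  have clE: "closedin (Cp K) S \<and> nowhere_dense_in (Cp K) S" if "S \<in> \<A>" for S
  proof -
    obtain P m where P: "P \<in> \<P>" and S: "S = A P m" using \<open>S \<in> \<A>\<close> by (auto simp: \<A>_def)
    show ?thesis
      unfolding S A_def
      using closedin_Cp_bounded_on[OF PK[OF P]] nowhere_dense_Cp_bounded_on[OF K PK[OF P] inf[OF P]]
      by blast
  qed
  have swE: "\<exists>n. C \<subseteq> E n" if "compactin (Cp K) C" for C
  proof -
    obtain P m where "P \<in> \<P>" "C \<subseteq> A P m" using swallow[OF \<open>compactin (Cp K) C\<close>] by blast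
    then have "A P m \<in> range E" unfolding rE \<A>_def by auto
    then show ?thesis using \<open>C \<subseteq> A P m\<close> by auto
  qed
  have "topspace (Cp K) = (\<Union>n. E n)"
  proof
    show "topspace (Cp K) \<subseteq> (\<Union>n. E n)"
    proof
      fix f assume "f \<in> topspace (Cp K)"
      \<comment> \<open>Singletons are compact, so covering is a case of swallowing compact
        sets.\<close>
      then show "f \<in> (\<Union>n. E n)" using swE[of "{f}"] by auto
    qed
    show "(\<Union>n. E n) \<subseteq> topspace (Cp K)"
      using rE by (auto simp: \<A>_def A_def)
  qed
  then show ?thesis
    unfolding property_B_def using clE rE swE by (intro exI[of _ E]) auto
qed

theorem theorem5p9:
  fixes K :: "'a topology"
  assumes "compact_space K" and "Hausdorff_space K"
  shows "(scattered_space K \<longleftrightarrow> frechet_urysohn_space (Cp K)) \<and>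
         (frechet_urysohn_space (Cp K) \<longleftrightarrow> \<not> property_B (Cp K))"
proof -
  \<comment> \<open>The zero function gives the nonemptiness that the diagonal argument requires.
    The three implications then close a cycle.\<close>
  have "topspace (Cp K) \<noteq> {}"
    using restrict_in_Cp[of K "\<lambda>_. 0"] by auto
  then show ?thesis
    using frechet_urysohn_Cp_if_scattered[OF assms] property_B_Cp_if_not_scattered[OF assms]
      frechet_urysohn_imp_not_property_B[OF Hausdorff_space_Cp] by blast
qed

end
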